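(* Let $B$ be a length-$n$, width-$w$, read-once, oblivious, regular branching program. Then, for every integer $k\ge 0$, $$L_2^k(B):=\sum_{s\in\{0,1\}^n:\,|s|=k}\left\|\widehat B[s]\right\|_2\le(2w^2)^k.$$
   Context: Write $[w]=\{1,\dots,w\}$. A length-$n$, width-$w$ program is a function $B:\{0,1\}^n\times[w]\to[w]$, written $B[x](u)$; it is identified with the matrix-valued function $x\mapsto B[x]\in\{0,1\}^{w\times w}$ where $B[x](u,v)=1$ iff $B[x](u)=v$. Concatenation of programs: $(B\circ B')[x\circ x']=B[x]\cdot B'[x']$ (matrix product). A length-$n$, width-$w$ ordered branching program is a program $B=B_1\circ\cdots\circ B_n$ with each layer $B_i$ a length-1, width-$w$ program. A read-once, oblivious branching program is a function of the form $B[x]=B'[\pi(x)]$ where $B'$ is an ordered branching program, $\pi$ is a permutation of $[n]$, and the $i$-th bit of $\pi(x)$ is the $\pi(i)$-th bit of $x$. It is regular if, for every layer $B'_i$, the matrix $\mathbb{E}_{U}[B'_i[U]]$ ($U$ a uniform bit) is doubly stochastic. For $F:\{0,1\}^n\to\mathbb{R}^{w\times w}$ and $s\in\{0,1\}^n$, $\widehat F[s]=\mathbb{E}_U[F[U]\chi_s(U)]\in\mathbb{R}^{w\times w}$ with $U$ uniform on $\{0,1\}^n$ and $\chi_s(x)=(-1)^{\sum_i x_is_i}$; $|s|$ is the Hamming weight. $\|A\|_2$ is the spectral norm of the matrix $A$. *)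

theory Defs
  imports "HOL-Analysis.Analysis" "HOL-Combinatorics.Permutations"
begin

text \<open>
  The state set of a width-$w$ program is a finite type \<open>'w\<close>, with $w$ = \<open>CARD('w)\<close>. Elements of
  $\{0,1\}^n$ are Boolean lists of length $n$, so bit positions and layers are indexed from 0.
  A length-$n$ program is a function \<open>bool list \<Rightarrow> 'w \<Rightarrow> 'w\<close>; only its values on lists of
  length $n$ matter.
\<close>

definition bitstrings :: "nat \<Rightarrow> bool list set" where
  "bitstrings n = {x. length x = n}"

text \<open>The expectation of \<open>f U\<close> for \<open>U\<close> uniform on the finite nonempty set \<open>S\<close>.\<close>

definition uniform_expectation :: "'a set \<Rightarrow> ('a \<Rightarrow> 'b::real_vector) \<Rightarrow> 'b" where
  "uniform_expectation S f = (\<Sum>x\<in>S. f x) /\<^sub>R real (card S)"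

definition transition_matrix :: "('w \<Rightarrow> 'w) \<Rightarrow> real ^ 'w ^ 'w" where
  "transition_matrix f = (\<chi> u v. if f u = v then 1 else 0)"

text \<open>
  The concatenation $B_1 \circ \cdots \circ B_n$ of length-1 programs, in matrix form. It is used
  only on inputs with as many bits as there are layers.
\<close>

primrec ordered_bp :: "(bool \<Rightarrow> 'w \<Rightarrow> 'w) list \<Rightarrow> bool list \<Rightarrow> real ^ 'w ^ 'w::finite" where
  "ordered_bp [] x = mat 1"
| "ordered_bp (L # Ls) x = transition_matrix (L (hd x)) ** ordered_bp Ls (tl x)"

definition doubly_stochastic :: "real ^ 'w ^ 'w::finite \<Rightarrow> bool" where
  "doubly_stochastic M \<longleftrightarrow>
     (\<forall>u v. 0 \<le> M $ u $ v) \<and> (\<forall>u. (\<Sum>v\<in>UNIV. M $ u $ v) = 1) \<and> (\<forall>v. (\<Sum>u\<in>UNIV. M $ u $ v) = 1)"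

definition regular_layer :: "(bool \<Rightarrow> 'w::finite \<Rightarrow> 'w) \<Rightarrow> bool" where
  "regular_layer L \<longleftrightarrow> doubly_stochastic (uniform_expectation UNIV (\<lambda>b. transition_matrix (L b)))"

text \<open>
  Entry \<open>i\<close> of \<open>permute_list \<pi> x\<close> is \<open>x ! \<pi> i\<close>, which is the convention for $\pi(x)$.
\<close>

definition regular_robp :: "nat \<Rightarrow> (bool list \<Rightarrow> 'w::finite \<Rightarrow> 'w) \<Rightarrow> bool" where
  "regular_robp n B \<longleftrightarrow>
     (\<exists>\<pi> Ls. \<pi> permutes {..<n} \<and> length Ls = n \<and> (\<forall>L\<in>set Ls. regular_layer L) \<and>
       (\<forall>x\<in>bitstrings n. transition_matrix (B x) = ordered_bp Ls (permute_list \<pi> x)))"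

definition character :: "bool list \<Rightarrow> bool list \<Rightarrow> real" where
  "character s x = (- 1) ^ (\<Sum>i<length s. of_bool (x ! i) * of_bool (s ! i))"

definition fourier_coeff :: "nat \<Rightarrow> (bool list \<Rightarrow> real ^ 'w ^ 'w) \<Rightarrow> bool list \<Rightarrow> real ^ 'w ^ 'w" where
  "fourier_coeff n F s = uniform_expectation (bitstrings n) (\<lambda>x. character s x *\<^sub>R F x)"

definition spectral_norm :: "real ^ 'w ^ 'w::finite \<Rightarrow> real" where
  "spectral_norm A = onorm (\<lambda>x. A *v x)"

text \<open>The level-$k$ Fourier mass $L_2^k$; \<open>count_list s True\<close> is the Hamming weight of \<open>s\<close>.\<close>

definition fourier_mass :: "nat \<Rightarrow> nat \<Rightarrow> (bool list \<Rightarrow> 'w::finite \<Rightarrow> 'w) \<Rightarrow> real" where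
  "fourier_mass n k B =
     (\<Sum>s\<in>{s \<in> bitstrings n. count_list s True = k}.
        spectral_norm (fourier_coeff n (\<lambda>x. transition_matrix (B x)) s))"

end

theory Submission
  imports Defs
begin

text \<open>
  After undoing the permutation of the input bits, a Fourier coefficient of an ordered program is
  the product of layer coefficients $\widehat{B_i}[s_i]$. For a regular layer with averaging matrix
  $M = \widehat L[0]$ and difference matrix $D = \widehat L[1]$, the potential
  $\Phi(y) = \sum_{u,v} |y_u - y_v|$ satisfies $\Phi(My) + \|Dy\|_1 \le \Phi(y)$. Applying this to
  all columns of a matrix $A$ that multiplies the program from the right bounds the level-$(k+1)$
  mass of the product by $\Phi(A)$ times a bound for level $k$: peel off layers from the end until
  the last 1 of $s$ is reached, which costs one factor $D$, and pay for it by the drop in potential.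
  The identity matrix has potential at most $2w^2$.
\<close>

section \<open>Fourier coefficients of a single layer\<close>

definition layer_coeff :: "(bool \<Rightarrow> 'w \<Rightarrow> 'w) \<Rightarrow> bool \<Rightarrow> real ^ 'w ^ 'w::finite" where
  "layer_coeff L b =
     uniform_expectation UNIV (\<lambda>c. (- 1) ^ (of_bool c * of_bool b) *\<^sub>R transition_matrix (L c))"

lemma layer_coeff_eq:
  "layer_coeff L False = (1/2) *\<^sub>R (transition_matrix (L False) + transition_matrix (L True))"
  "layer_coeff L True = (1/2) *\<^sub>R (transition_matrix (L False) - transition_matrix (L True))"
  by (simp_all add: layer_coeff_def uniform_expectation_def UNIV_bool scaleR_add_right)

lemma transition_matrix_mult_vec: "(transition_matrix f *v y) $ u = y $ f u"
  by (simp add: transition_matrix_def matrix_vector_mult_def if_distrib [where f="\<lambda>x. x * _"] cong: if_cong)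

lemma layer_coeff_mult_vec:
  "(layer_coeff L False *v y) $ u = (y $ L False u + y $ L True u) / 2"
  "(layer_coeff L True *v y) $ u = (y $ L False u - y $ L True u) / 2"
  by (simp_all add: layer_coeff_eq matrix_vector_mult_add_rdistrib
      matrix_vector_mult_diff_rdistrib transition_matrix_mult_vec
      flip: scaleR_matrix_vector_assoc)

lemma regular_layer_doubly_stochastic:
  "regular_layer L \<Longrightarrow> doubly_stochastic (layer_coeff L False)"
  by (simp add: regular_layer_def layer_coeff_def)

text \<open>Row \<open>u\<close> of \<open>?M\<close> averages \<open>f\<close> over the two
  successors of \<open>u\<close>. After the two sums are exchanged, only the column sums of
  \<open>?M\<close> remain, and regularity makes them 1. This is the form in which regularity enters
  the potential argument.\<close>

lemma regular_layer_sum: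
  fixes f :: "'w::finite \<Rightarrow> real"
  assumes "regular_layer L"
  shows "(\<Sum>u\<in>UNIV. f (L False u) + f (L True u)) = 2 * (\<Sum>v\<in>UNIV. f v)"
proof -
  let ?M = "layer_coeff L False"
  have "(\<Sum>u\<in>UNIV. f (L False u) + f (L True u)) = (\<Sum>u\<in>UNIV. 2 * (?M *v (\<chi> v. f v)) $ u)"
    by (simp add: layer_coeff_mult_vec del: distrib_left_numeral)
  also have "\<dots> = 2 * (\<Sum>u\<in>UNIV. \<Sum>v\<in>UNIV. ?M $ u $ v * f v)"
    by (simp add: matrix_vector_mult_def sum_distrib_left)
  also have "\<dots> = 2 * (\<Sum>v\<in>UNIV. (\<Sum>u\<in>UNIV. ?M $ u $ v) * f v)"
    by (subst sum.swap) (simp add: sum_distrib_right)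
  also have "\<dots> = 2 * (\<Sum>v\<in>UNIV. f v)"
    using regular_layer_doubly_stochastic [OF assms] by (simp add: doubly_stochastic_def)
  finally show ?thesis .
qed

section \<open>The potential and its decrease across a layer\<close>

definition variation :: "real ^ 'w::finite \<Rightarrow> real" where
  "variation y = (\<Sum>u\<in>UNIV. \<Sum>v\<in>UNIV. \<bar>y $ u - y $ v\<bar>)"

lemma variation_nonneg: "0 \<le> variation y"
  by (simp add: variation_def sum_nonneg)

lemma variation_layer:
  assumes "regular_layer L"
  shows "variation (layer_coeff L False *v y) + (\<Sum>u\<in>UNIV. \<bar>(layer_coeff L True *v y) $ u\<bar>)
           \<le> variation y"
proof -
  define a where "a u = y $ L False u" for u
  define b where "b u = y $ L True u" for u
  \<comment> \<open>Every state has in-degree 2, so summing over edges counts each state twice.\<close>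
  have "4 * variation y
      = 2 * (\<Sum>u\<in>UNIV. 2 * (\<Sum>v\<in>UNIV. \<bar>y $ u - y $ v\<bar>))"
    by (simp add: variation_def sum_distrib_left)
  also have "\<dots> = 2 * (\<Sum>u\<in>UNIV. \<Sum>v\<in>UNIV. \<bar>y $ u - a v\<bar> + \<bar>y $ u - b v\<bar>)"
    using regular_layer_sum [OF assms, where f = "\<lambda>v. \<bar>y $ _ - y $ v\<bar>"]
    by (simp add: a_def b_def)
  also have "\<dots> = (\<Sum>u\<in>UNIV. \<Sum>v\<in>UNIV.
      \<bar>a u - a v\<bar> + \<bar>a u - b v\<bar> + \<bar>b u - a v\<bar> + \<bar>b u - b v\<bar>)"
    using regular_layer_sum [OF assms, where f = "\<lambda>x. \<Sum>v\<in>UNIV. \<bar>y $ x - a v\<bar> + \<bar>y $ x - b v\<bar>"]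
    by (simp add: a_def b_def sum.distrib add.assoc)
  \<comment> \<open>The triangle inequality off the diagonal; the diagonal terms pay for the differences.\<close>
  also have "\<dots> \<ge> (\<Sum>u\<in>UNIV. \<Sum>v\<in>UNIV.
      4 * \<bar>(a u + b u) / 2 - (a v + b v) / 2\<bar> + (if v = u then 2 * \<bar>a u - b u\<bar> else 0))"
    by (intro sum_mono) (auto simp: abs_if field_simps)
  finally have "(\<Sum>u\<in>UNIV. \<Sum>v\<in>UNIV.
      4 * \<bar>(a u + b u) / 2 - (a v + b v) / 2\<bar> + (if v = u then 2 * \<bar>a u - b u\<bar> else 0))
      \<le> 4 * variation y" .
  \<comment> \<open>Since 2\<bar>a u - b u\<bar> = 4\<bar>(a u - b u) / 2\<bar>, both sums carry the
    factor 4, and cancelling it leaves the difference term with coefficient 1.\<close>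
  then have "4 * (\<Sum>u\<in>UNIV. \<Sum>v\<in>UNIV. \<bar>(a u + b u) / 2 - (a v + b v) / 2\<bar>)
      + 4 * (\<Sum>u\<in>UNIV. \<bar>(a u - b u) / 2\<bar>) \<le> 4 * variation y"
    by (simp add: sum.distrib sum_distrib_left)
  then show ?thesis
    by (simp add: variation_def [of "_ *v _"] layer_coeff_mult_vec a_def b_def)
qed

definition column_variation :: "real ^ 'w ^ 'w::finite \<Rightarrow> real" where
  "column_variation A = (\<Sum>v\<in>UNIV. variation (column v A))"

lemma column_matrix_mult: "column v (A ** B) = A *v column v B"
  by (simp add: column_def matrix_matrix_mult_def matrix_vector_mult_def vec_eq_iff)

text \<open>The spectral norm is at most the sum of the absolute values of all entries. Grouped by
  columns, that sum consists of the 1-norms that \<open>variation_layer\<close> controls, so the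
  claim is \<open>variation_layer\<close> summed over the columns of \<open>A\<close>.\<close>

lemma column_variation_layer:
  assumes "regular_layer L"
  shows "column_variation (layer_coeff L False ** A) + spectral_norm (layer_coeff L True ** A)
           \<le> column_variation A"
proof -
  have "spectral_norm (layer_coeff L True ** A)
      \<le> (\<Sum>u\<in>UNIV. \<Sum>v\<in>UNIV. \<bar>(layer_coeff L True ** A) $ u $ v\<bar>)"
    unfolding spectral_norm_def by (rule onorm_le_matrix_component_sum)
  also have "\<dots> = (\<Sum>v\<in>UNIV. \<Sum>u\<in>UNIV. \<bar>(layer_coeff L True *v column v A) $ u\<bar>)"
    by (subst sum.swap) (simp flip: column_matrix_mult, simp add: column_def)
  finally have "column_variation (layer_coeff L False ** A) + spectral_norm (layer_coeff L True ** A)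
      \<le> (\<Sum>v\<in>UNIV. variation (layer_coeff L False *v column v A)
          + (\<Sum>u\<in>UNIV. \<bar>(layer_coeff L True *v column v A) $ u\<bar>))"
    by (simp add: column_variation_def column_matrix_mult sum.distrib)
  also have "\<dots> \<le> column_variation A"
    unfolding column_variation_def by (intro sum_mono variation_layer assms)
  finally show ?thesis .
qed

lemma column_variation_nonneg: "0 \<le> column_variation A"
  by (simp add: column_variation_def sum_nonneg variation_nonneg)

lemma column_variation_mat_1: "column_variation (mat 1 :: real ^ 'w ^ 'w::finite) \<le> 2 * (real CARD('w))\<^sup>2"
proof -
  have "variation (column v (mat 1 :: real ^ 'w ^ 'w)) \<le> 2 * real CARD('w)" for v
  proof -
    \<comment> \<open>Column \<open>v\<close> is the indicator of \<open>v\<close>, so two of its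
      entries differ only if one of the two indices is \<open>v\<close>. Each summand on the right
      contributes w in total.\<close>
    have "variation (column v (mat 1 :: real ^ 'w ^ 'w))
        \<le> (\<Sum>u\<in>(UNIV :: 'w set). \<Sum>u'\<in>(UNIV :: 'w set). of_bool (u = v) + of_bool (u' = v))"
      unfolding variation_def by (intro sum_mono) (auto simp: column_def mat_def)
    also have "\<dots> = 2 * real CARD('w)"
      by (simp add: sum.distrib of_bool_def flip: sum_distrib_left)
    finally show ?thesis .
  qed
  then have "column_variation (mat 1 :: real ^ 'w ^ 'w) \<le> (\<Sum>v\<in>(UNIV :: 'w set). 2 * real CARD('w))"
    unfolding column_variation_def by (intro sum_mono)
  then show ?thesis by (simp add: power2_eq_square)
qed

section \<open>Spectral norm bounds\<close>

lemma spectral_norm_mult: "spectral_norm (A ** B) \<le> spectral_norm A * spectral_norm B"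
  unfolding spectral_norm_def
  using onorm_compose [of "(*v) A" "(*v) B"] by (simp add: o_def matrix_vector_mul_assoc)

lemma spectral_norm_nonneg: "0 \<le> spectral_norm A"
  unfolding spectral_norm_def by (rule onorm_pos_le) simp

lemma spectral_norm_mat_1: "spectral_norm (mat 1 :: real ^ 'w ^ 'w::finite) \<le> 1"
  by (simp add: spectral_norm_def onorm_le)

text \<open>Each row is a probability vector, so Jensen's inequality for the square bounds every
  squared output coordinate by a weighted average of squared inputs. Summed over the rows, the
  weights collapse because the columns also sum to 1.\<close>

lemma spectral_norm_doubly_stochastic:
  fixes M :: "real ^ 'w ^ 'w::finite"
  assumes "doubly_stochastic M"
  shows "spectral_norm M \<le> 1"
  unfolding spectral_norm_def
proof (rule onorm_le)
  fix x :: "real ^ 'w"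
  have M: "0 \<le> M $ u $ v" "(\<Sum>v\<in>UNIV. M $ u $ v) = 1" "(\<Sum>u\<in>UNIV. M $ u $ v) = 1" for u v
    using assms by (auto simp: doubly_stochastic_def)
  have "((M *v x) $ u)\<^sup>2 \<le> (\<Sum>v\<in>UNIV. M $ u $ v * (x $ v)\<^sup>2)" for u
    using convex_on_sum [OF _ _ convex_power2, of UNIV "\<lambda>v. M $ u $ v" "\<lambda>v. x $ v"] M
    by (simp add: matrix_vector_mult_def)
  then have "(\<Sum>u\<in>UNIV. ((M *v x) $ u)\<^sup>2) \<le> (\<Sum>u\<in>UNIV. \<Sum>v\<in>UNIV. M $ u $ v * (x $ v)\<^sup>2)"
    by (intro sum_mono)
  also have "\<dots> = (\<Sum>v\<in>UNIV. (x $ v)\<^sup>2)"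
    by (subst sum.swap) (simp add: M flip: sum_distrib_right)
  finally show "norm (M *v x) \<le> 1 * norm x"
    by (simp add: norm_vec_def L2_set_def)
qed

section \<open>Appending a layer to an ordered program\<close>

lemma finite_bitstrings: "finite (bitstrings n)"
  using finite_lists_length_eq [of "UNIV :: bool set" n] by (simp add: bitstrings_def)

lemma card_bitstrings: "card (bitstrings n) = 2 ^ n"
  using card_lists_length_eq [of "UNIV :: bool set" n] by (simp add: bitstrings_def card_UNIV_bool)

lemma bij_betw_snoc_bitstrings:
  "bij_betw (\<lambda>(x, c). x @ [c]) (bitstrings n \<times> UNIV) (bitstrings (Suc n))"
  unfolding bij_betw_def
proof
  show "(\<lambda>(x, c). x @ [c]) ` (bitstrings n \<times> UNIV) = bitstrings (Suc n)"
    by (auto simp: bitstrings_def length_Suc_conv_rev image_iff)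
qed (auto simp: inj_on_def)

lemma sum_bitstrings_Suc:
  "(\<Sum>x\<in>bitstrings (Suc n). f x) = (\<Sum>x\<in>bitstrings n. \<Sum>c\<in>UNIV. f (x @ [c]))"
  by (subst sum.reindex_bij_betw [OF bij_betw_snoc_bitstrings, symmetric])
     (simp add: sum.cartesian_product case_prod_unfold)

text \<open>\<open>ordered_bp\<close> recurses from the front, while the main induction peels layers
  off the end. The length hypothesis aligns bits with layers, so that \<open>c\<close> is the bit
  read by \<open>L\<close>.\<close>

lemma ordered_bp_snoc:
  "length x = length Ls \<Longrightarrow>
     ordered_bp (Ls @ [L]) (x @ [c]) = ordered_bp Ls x ** transition_matrix (L c)"
proof (induction Ls arbitrary: x)
  case (Cons K Ls)
  then show ?case by (cases x) (auto simp: matrix_mul_assoc)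
qed simp

lemma character_snoc:
  "length x = length s \<Longrightarrow>
     character (s @ [b]) (x @ [c]) = character s x * (- 1) ^ (of_bool c * of_bool b)"
  by (simp add: character_def nth_append power_add)

lemma matrix_mult_sum_left: "(\<Sum>x\<in>S. f x) ** (A :: real ^ 'w ^ 'w::finite) = (\<Sum>x\<in>S. f x ** A)"
  by (simp add: matrix_matrix_mult_def vec_eq_iff sum_distrib_right sum.swap [of _ _ S])

lemma matrix_mult_sum_right: "(A :: real ^ 'w ^ 'w::finite) ** (\<Sum>x\<in>S. f x) = (\<Sum>x\<in>S. A ** f x)"
  by (simp add: matrix_matrix_mult_def vec_eq_iff sum_distrib_left sum.swap [of _ _ S])

text \<open>The character is multiplicative and the matrix product bilinear, so the sum over all
  inputs factors into a sum over prefixes and a sum over the last bit. The normalisation splits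
  likewise into 2^n and 2.\<close>

lemma fourier_coeff_snoc:
  assumes "length s = length Ls"
  shows "fourier_coeff (Suc (length Ls)) (ordered_bp (Ls @ [L])) (s @ [b])
           = fourier_coeff (length Ls) (ordered_bp Ls) s ** layer_coeff L b"
proof -
  have "(\<Sum>x\<in>bitstrings (Suc (length Ls)). character (s @ [b]) x *\<^sub>R ordered_bp (Ls @ [L]) x)
      = (\<Sum>x\<in>bitstrings (length Ls). \<Sum>c\<in>UNIV. (character s x *\<^sub>R ordered_bp Ls x) **
            ((- 1) ^ (of_bool c * of_bool b) *\<^sub>R transition_matrix (L c)))"
    unfolding sum_bitstrings_Suc
    by (intro sum.cong refl)
       (simp add: bitstrings_def assms ordered_bp_snoc character_snoc scalar_matrix_assoc
         matrix_scalar_ac mult.commute)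
  also have "\<dots> = (\<Sum>x\<in>bitstrings (length Ls). character s x *\<^sub>R ordered_bp Ls x) **
      (\<Sum>c\<in>UNIV. (- 1) ^ (of_bool c * of_bool b) *\<^sub>R transition_matrix (L c))"
    by (subst sum.swap) (simp only: matrix_mult_sum_left matrix_mult_sum_right)
  finally show ?thesis
    by (simp add: fourier_coeff_def layer_coeff_def uniform_expectation_def card_bitstrings
         scalar_matrix_assoc matrix_scalar_ac card_UNIV_bool)
qed

section \<open>Level sums of ordered programs, by induction on the level\<close>

definition level :: "nat \<Rightarrow> nat \<Rightarrow> bool list set" where
  "level n k = {s \<in> bitstrings n. count_list s True = k}"

lemma length_level: "s \<in> level n k \<Longrightarrow> length s = n"
  by (simp add: level_def bitstrings_def)

lemma sum_level: "(\<Sum>s\<in>level n k. f s) = (\<Sum>s\<in>bitstrings n. if count_list s True = k then f s else 0)"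
  by (simp add: level_def sum.inter_filter finite_bitstrings)

lemma sum_level_Suc:
  fixes f :: "bool list \<Rightarrow> real"
  shows "(\<Sum>s\<in>level (Suc n) (Suc k). f s)
           = (\<Sum>s\<in>level n (Suc k). f (s @ [False])) + (\<Sum>s\<in>level n k. f (s @ [True]))"
    and "(\<Sum>s\<in>level (Suc n) 0. f s) = (\<Sum>s\<in>level n 0. f (s @ [False]))"
  by (simp_all add: sum_level sum_bitstrings_Suc UNIV_bool flip: sum.distrib)

lemma level_0: "level 0 k = (if k = 0 then {[]} else {})"
  by (auto simp: level_def bitstrings_def)

lemma fourier_coeff_Nil: "fourier_coeff 0 (ordered_bp []) [] = mat 1"
  by (simp add: fourier_coeff_def uniform_expectation_def bitstrings_def character_def)

text \<open>The only string of weight 0 is all \<open>False\<close>, and its coefficient is a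
  product of doubly stochastic matrices, each of norm at most 1.\<close>

lemma sum_level_zero_le:
  assumes "\<forall>L\<in>set Ls. regular_layer L"
  shows "(\<Sum>s\<in>level (length Ls) 0. spectral_norm (fourier_coeff (length Ls) (ordered_bp Ls) s)) \<le> 1"
  using assms
proof (induction Ls rule: rev_induct)
  case Nil
  show ?case by (simp add: level_0 fourier_coeff_Nil spectral_norm_mat_1 del: ordered_bp.simps)
next
  case (snoc L Ls)
  let ?C = "fourier_coeff (length Ls) (ordered_bp Ls)"
  have "(\<Sum>s\<in>level (length Ls) 0. spectral_norm (?C s ** layer_coeff L False))
      \<le> (\<Sum>s\<in>level (length Ls) 0. spectral_norm (?C s))"
  proof (rule sum_mono)
    fix s
    have "spectral_norm (layer_coeff L False) \<le> 1"
      using snoc.prems by (simp add: spectral_norm_doubly_stochastic regular_layer_doubly_stochastic)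
    then show "spectral_norm (?C s ** layer_coeff L False) \<le> spectral_norm (?C s)"
      using spectral_norm_mult [of "?C s" "layer_coeff L False"] spectral_norm_nonneg [of "?C s"]
      by (meson mult_left_le order_trans)
  qed
  also have "\<dots> \<le> 1" using snoc by simp
  finally show ?case
    by (simp add: sum_level_Suc fourier_coeff_snoc length_level cong: sum.cong)
qed

text \<open>\<open>A\<close> collects the coefficients of the layers already peeled off, so it has
  to be arbitrary in the induction. The bound \<open>c\<close> is assumed for all regular programs
  because it is applied to whatever prefix precedes the last 1 of \<open>s\<close>.\<close>

lemma sum_level_mult_le:
  fixes Ls :: "(bool \<Rightarrow> 'w::finite \<Rightarrow> 'w) list"
  assumes regular: "\<forall>L\<in>set Ls. regular_layer L"
    and "0 \<le> c"
    and level_k: "\<And>Ls :: (bool \<Rightarrow> 'w::finite \<Rightarrow> 'w) list. \<forall>L\<in>set Ls. regular_layer L \<Longrightarrow>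
      (\<Sum>s\<in>level (length Ls) k. spectral_norm (fourier_coeff (length Ls) (ordered_bp Ls) s)) \<le> c"
  shows "(\<Sum>s\<in>level (length Ls) (Suc k).
      spectral_norm (fourier_coeff (length Ls) (ordered_bp Ls) s ** A)) \<le> c * column_variation A"
  using regular
proof (induction Ls arbitrary: A rule: rev_induct)
  case Nil
  show ?case using \<open>0 \<le> c\<close> by (simp add: level_0 column_variation_nonneg)
next
  case (snoc L Ls)
  let ?C = "fourier_coeff (length Ls) (ordered_bp Ls)"
  let ?M = "layer_coeff L False" and ?D = "layer_coeff L True"
  have "(\<Sum>s\<in>level (length Ls) k. spectral_norm (?C s ** (?D ** A)))
      \<le> (\<Sum>s\<in>level (length Ls) k. spectral_norm (?C s)) * spectral_norm (?D ** A)"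
    unfolding sum_distrib_right by (intro sum_mono spectral_norm_mult)
  also have "\<dots> \<le> c * spectral_norm (?D ** A)"
    using snoc.prems by (intro mult_right_mono level_k spectral_norm_nonneg) auto
  \<comment> \<open>The strings are split by their last bit. A final \<open>False\<close> stays at
    level \<open>Suc k\<close>, where the induction hypothesis applies to \<open>?M ** A\<close>; a
    final \<open>True\<close> drops to level \<open>k\<close>, which was bounded just above.\<close>
  finally have "(\<Sum>s\<in>level (length Ls) (Suc k). spectral_norm (?C s ** (?M ** A)))
      + (\<Sum>s\<in>level (length Ls) k. spectral_norm (?C s ** (?D ** A)))
      \<le> c * column_variation (?M ** A) + c * spectral_norm (?D ** A)"
    using snoc by (intro add_mono) auto
  also have "\<dots> \<le> c * column_variation A"
    using column_variation_layer [of L A] snoc.prems \<open>0 \<le> c\<close>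
    by (simp add: mult_left_mono flip: distrib_left)
  finally show ?case
    by (simp add: sum_level_Suc fourier_coeff_snoc length_level matrix_mul_assoc
        cong: sum.cong)
qed

lemma ordered_fourier_mass_le:
  fixes Ls :: "(bool \<Rightarrow> 'w::finite \<Rightarrow> 'w) list"
  assumes "\<forall>L\<in>set Ls. regular_layer L"
  shows "(\<Sum>s\<in>level (length Ls) k. spectral_norm (fourier_coeff (length Ls) (ordered_bp Ls) s))
           \<le> (2 * (real CARD('w))\<^sup>2) ^ k"
  using assms
proof (induction k arbitrary: Ls)
  case 0
  then show ?case by (simp add: sum_level_zero_le)
next
  case (Suc k)
  let ?c = "2 * (real CARD('w))\<^sup>2"
  \<comment> \<open>No layer has been peeled off at the start, so the accumulated factor is the
    identity.\<close>
  have "(\<Sum>s\<in>level (length Ls) (Suc k).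
      spectral_norm (fourier_coeff (length Ls) (ordered_bp Ls) s ** mat 1))
      \<le> ?c ^ k * column_variation (mat 1 :: real ^ 'w ^ 'w)"
    using Suc by (intro sum_level_mult_le) auto
  also have "\<dots> \<le> ?c ^ k * ?c"
    by (intro mult_left_mono column_variation_mat_1) simp
  finally show ?case by (simp add: mult.commute)
qed

section \<open>Undoing the permutation of the input bits\<close>

lemma bij_betw_permute_list_bitstrings:
  assumes "\<pi> permutes {..<n}"
  shows "bij_betw (permute_list \<pi>) (bitstrings n) (bitstrings n)"
proof -
  have inverses: "permute_list (inv \<pi>) (permute_list \<pi> s) = s"
      "permute_list \<pi> (permute_list (inv \<pi>) s) = s" if "length s = n" for s :: "bool list"
    using assms that permutes_inv [OF assms]
    by (simp_all add: permutes_inv_o flip: permute_list_compose)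
  then show ?thesis
    by (intro bij_betw_byWitness [where f' = "permute_list (inv \<pi>)"]) (auto simp: bitstrings_def)
qed

lemma bij_betw_permute_list_level:
  assumes "\<pi> permutes {..<n}"
  shows "bij_betw (permute_list \<pi>) (level n k) (level n k)"
proof -
  \<comment> \<open>The Hamming weight depends only on the multiset of bits.\<close>
  have count: "count_list (permute_list \<pi> s) True = count_list s True" if "s \<in> bitstrings n" for s
    using assms that by (simp add: bitstrings_def flip: count_mset)
  show ?thesis
    unfolding level_def
    by (rule bij_betw_Collect [OF bij_betw_permute_list_bitstrings [OF assms]]) (simp add: count)
qed

lemma character_permute_list:
  assumes "\<pi> permutes {..<n}" "length s = n" "length x = n"
  shows "character (permute_list \<pi> s) (permute_list \<pi> x) = character s x"
proof -
  have "(\<Sum>i<n. of_bool (x ! \<pi> i) * of_bool (s ! \<pi> i) :: nat)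
      = (\<Sum>i<n. of_bool (x ! i) * of_bool (s ! i))"
    by (rule sum.reindex_bij_betw [OF permutes_imp_bij [OF assms(1)]])
  then show ?thesis
    using assms by (simp add: character_def permute_list_nth)
qed

text \<open>Permuting \<open>s\<close> and \<open>x\<close> together preserves the character, so the
  substitution of \<open>permute_list \<pi> x\<close> by \<open>x\<close> moves the same
  permutation, not its inverse, onto \<open>s\<close>.\<close>

lemma fourier_coeff_permute:
  assumes "\<pi> permutes {..<n}" "length s = n"
  shows "fourier_coeff n (\<lambda>x. F (permute_list \<pi> x)) s = fourier_coeff n F (permute_list \<pi> s)"
proof -
  have "(\<Sum>x\<in>bitstrings n. character s x *\<^sub>R F (permute_list \<pi> x))
      = (\<Sum>x\<in>bitstrings n. character (permute_list \<pi> s) (permute_list \<pi> x) *\<^sub>R F (permute_list \<pi> x))"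
    by (intro sum.cong refl) (simp add: bitstrings_def character_permute_list [OF assms])
  also have "\<dots> = (\<Sum>x\<in>bitstrings n. character (permute_list \<pi> s) x *\<^sub>R F x)"
    by (rule sum.reindex_bij_betw [OF bij_betw_permute_list_bitstrings [OF assms(1)]])
  finally show ?thesis by (simp add: fourier_coeff_def uniform_expectation_def)
qed

theorem theorem3p2:
  fixes B :: "bool list \<Rightarrow> 'w::finite \<Rightarrow> 'w" and n k :: nat
  assumes "regular_robp n B"
  shows "fourier_mass n k B \<le> (2 * (real CARD('w))\<^sup>2) ^ k"
proof -
  obtain \<pi> Ls where \<pi>: "\<pi> permutes {..<n}" and Ls: "length Ls = n" "\<forall>L\<in>set Ls. regular_layer L"
    and B: "\<And>x. x \<in> bitstrings n \<Longrightarrow> transition_matrix (B x) = ordered_bp Ls (permute_list \<pi> x)"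
    using assms by (auto simp: regular_robp_def)
  have coeff: "fourier_coeff n (\<lambda>x. transition_matrix (B x)) s
      = fourier_coeff n (ordered_bp Ls) (permute_list \<pi> s)" if "s \<in> level n k" for s
  proof -
    have "fourier_coeff n (\<lambda>x. transition_matrix (B x)) s
        = fourier_coeff n (\<lambda>x. ordered_bp Ls (permute_list \<pi> x)) s"
      by (simp add: fourier_coeff_def uniform_expectation_def B)
    then show ?thesis
      using that by (simp add: fourier_coeff_permute \<pi> level_def bitstrings_def)
  qed
  have "fourier_mass n k B
      = (\<Sum>s\<in>level n k. spectral_norm (fourier_coeff n (ordered_bp Ls) (permute_list \<pi> s)))"
    using coeff by (simp add: fourier_mass_def flip: level_def)
  \<comment> \<open>The permutation only rearranges the coefficients within a level, so the mass is
    that of the ordered program.\<close>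
  also have "\<dots> = (\<Sum>s\<in>level n k. spectral_norm (fourier_coeff n (ordered_bp Ls) s))"
    by (rule sum.reindex_bij_betw [OF bij_betw_permute_list_level [OF \<pi>]])
  also have "\<dots> \<le> (2 * (real CARD('w))\<^sup>2) ^ k"
    using ordered_fourier_mass_le [of Ls k] Ls by simp
  finally show ?thesis .
qed

end
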